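(* Let $q$ be a complex number with $0<|q|<1$, and set $$A_3:=\frac{\varphi(-q)\varphi(-q^3)}{q^{4}\psi(q^8)\psi(q^{24})},\qquad B_3:=\frac{\varphi(-q)\psi(q^{24})}{q^{-2}\varphi(-q^3)\psi(q^8)}.$$ Then $$B^2_3+\frac{1}{B^2_3}=12\left(B_3+\frac{1}{B_3}\right)+\left(A_3+\frac{8^2}{A_3}\right)+6\left(\sqrt{A_3}+\frac{8}{\sqrt{A_3}}\right)\left(\sqrt{B_3}+\frac{1}{\sqrt{B_3}}\right)+30.$$
   Context: For $|q|<1$, $\varphi(q)=\sum_{m=-\infty}^{\infty}q^{m^2}$ and $\psi(q)=\sum_{m=0}^{\infty}q^{m(m+1)/2}$. The square roots $\sqrt{A_3},\sqrt{B_3}$ are chosen so that $\sqrt{A_3}\sqrt{B_3}=\dfrac{\varphi(-q)}{q\psi(q^8)}$; for $0<q<1$, $A_3$ and $B_3$ are positive and these are the positive square roots. *)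

theory Defs
  imports "HOL-Analysis.Analysis"
begin

text \<open>Ramanujan's theta functions \<open>\<phi>\<close> and \<open>\<psi>\<close>; both series converge
  absolutely for \<open>norm q < 1\<close> and are meaningful only there.\<close>

definition ramanujan_phi :: "complex \<Rightarrow> complex" where
  "ramanujan_phi q = (\<Sum>\<^sub>\<infinity>m\<in>(UNIV::int set). q powi (m\<^sup>2))"

definition ramanujan_psi :: "complex \<Rightarrow> complex" where
  "ramanujan_psi q = (\<Sum>m. q ^ (m * (m + 1) div 2))"

definition A3 :: "complex \<Rightarrow> complex" where
  "A3 q = (ramanujan_phi (- q) * ramanujan_phi (- (q ^ 3)))
          / (q ^ 4 * ramanujan_psi (q ^ 8) * ramanujan_psi (q ^ 24))"

definition B3 :: "complex \<Rightarrow> complex" where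
  "B3 q = (ramanujan_phi (- q) * ramanujan_psi (q ^ 24))
          / (q powi (- 2) * ramanujan_phi (- (q ^ 3)) * ramanujan_psi (q ^ 8))"

text \<open>\<open>a\<close> and \<open>b\<close> are square roots of \<open>A3 q\<close> and \<open>B3 q\<close>, with signs normalised by the value of
  their product. This leaves only the simultaneous change of sign of \<open>a\<close> and \<open>b\<close>.
  For \<open>0 < q < 1\<close> the quotient below is positive, so the two positive roots are an
  admissible choice.\<close>

definition admissible_roots :: "complex \<Rightarrow> complex \<Rightarrow> complex \<Rightarrow> bool" where
  "admissible_roots q a b \<longleftrightarrow>
     a\<^sup>2 = A3 q \<and> b\<^sup>2 = B3 q \<and>
     a * b = ramanujan_phi (- q) / (q * ramanujan_psi (q ^ 8))"

end

theory Submission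
  imports Defs
begin

text \<open>
  Put \<open>P = \<phi>(-q)/(q \<psi>(q\<^sup>8))\<close> and let \<open>Q\<close> be the same quotient at \<open>q\<^sup>3\<close>, so that
  \<open>A\<^sub>3 = P Q\<close> and \<open>B\<^sub>3 = P/Q\<close>. The dissection \<open>\<phi>(q) = \<phi>(q\<^sup>4) + 2q \<psi>(q\<^sup>8)\<close> gives
  \<open>P + 2 = u\<close> and \<open>Q + 2 = v\<close> with \<open>u = \<phi>(q\<^sup>4)/(q \<psi>(q\<^sup>8))\<close>. At the nome \<open>q\<^sup>4\<close>,
  Jacobi's quartic identity and the cubic identity
  \<open>\<phi>(q)\<phi>(q\<^sup>3) - \<phi>(-q)\<phi>(-q\<^sup>3) = 4q \<psi>(q\<^sup>2)\<psi>(q\<^sup>6)\<close> yield \<open>(u\<^sup>4 - 16)(v\<^sup>4 - 16) = (uv - 4)\<^sup>4\<close>,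
  which is the claim after clearing denominators. The theta identities come from splitting
  lattice sums over \<open>\<int>\<^sup>2\<close> according to the parity of the coordinate difference and changing variables.
\<close>

section \<open>Sums over the integers and over pairs of integers\<close>

lemma bij_int_nonneg: "bij_betw int UNIV {0..}"
  by (rule bij_betwI[where g = nat]) auto

lemma bij_int_neg: "bij_betw (\<lambda>n. - 1 - int n) UNIV {..<0}"
  by (rule bij_betwI[where g = "\<lambda>k. nat (- 1 - k)"]) auto

lemma UNIV_int_split: "(UNIV :: int set) = {0..} \<union> {..<0}"
  by auto

text \<open>The map \<open>n \<mapsto> - 1 - n\<close> enumerates the negative integers from 0 on,
  so both half-lines are copies of the naturals and compare with the same geometric series.\<close>

lemma abs_summable_on_int_geometric:
  fixes a :: "int \<Rightarrow> complex"
  assumes "0 \<le> r" "r < 1"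
    and pos: "\<And>n. norm (a (int n)) \<le> r ^ n"
    and neg: "\<And>n. norm (a (- 1 - int n)) \<le> r ^ n"
  shows "(\<lambda>m. norm (a m)) summable_on UNIV"
proof -
  have geo: "summable (\<lambda>n. r ^ n)"
    using assms by (simp add: summable_geometric)
  have "summable (\<lambda>n. norm (norm (b n)))" if "\<And>n. norm (b n) \<le> r ^ n" for b :: "nat \<Rightarrow> complex"
    by (rule summable_comparison_test[OF _ geo]) (use that in auto)
  hence nat: "(\<lambda>n. norm (b n)) summable_on UNIV" if "\<And>n. norm (b n) \<le> r ^ n" for b :: "nat \<Rightarrow> complex"
    using that by (intro norm_summable_imp_summable_on) auto
  have "(\<lambda>m. norm (a m)) summable_on {0..}"
    using nat[OF pos] summable_on_reindex_bij_betw[OF bij_int_nonneg, of "\<lambda>x. norm (a x)"] by simp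
  moreover have "(\<lambda>m. norm (a m)) summable_on {..<0}"
    using nat[OF neg] summable_on_reindex_bij_betw[OF bij_int_neg, of "\<lambda>x. norm (a x)"] by simp
  ultimately show ?thesis
    unfolding UNIV_int_split by (rule summable_on_Un_disjoint) auto
qed

lemma norm_power_int_le_power:
  fixes q :: complex
  assumes "norm q < 1" "int n \<le> e"
  shows "norm (q powi e) \<le> norm q ^ n"
proof -
  have "q powi e = q ^ nat e"
    using assms(2) by (simp add: power_int_def)
  moreover have "n \<le> nat e"
    using assms(2) by simp
  ultimately show ?thesis
    using assms(1) by (simp add: norm_power power_decreasing)
qed

lemma abs_summable_power_int:
  fixes q :: complex and e :: "int \<Rightarrow> int"
  assumes "norm q < 1" "\<And>n. int n \<le> e (int n)" "\<And>n. int n \<le> e (- 1 - int n)"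
  shows "(\<lambda>m. norm (q powi (e m))) summable_on UNIV"
  by (rule abs_summable_on_int_geometric[of "norm q" "\<lambda>m. q powi (e m)"]) (use assms norm_power_int_le_power in auto)

lemma summable_norm_le_geometric:
  fixes b :: "nat \<Rightarrow> complex"
  assumes "0 \<le> r" "r < 1" "\<And>n. norm (b n) \<le> r ^ n"
  shows "summable (\<lambda>n. norm (b n))"
  by (rule summable_comparison_test[of _ "\<lambda>n. r ^ n"])
     (use assms in \<open>auto simp: summable_geometric\<close>)

text \<open>Removing the constant term leaves a tail dominated by \<open>r + r^2 + ...\<close>. This
  keeps the theta series away from zero near the origin.\<close>

lemma norm_suminf_minus_1_le:
  fixes b :: "nat \<Rightarrow> complex"
  assumes "0 \<le> r" "r < 1" "\<And>n. norm (b n) \<le> r ^ n" "b 0 = 1"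
  shows "norm (suminf b - 1) \<le> r / (1 - r)"
proof -
  have s: "summable (\<lambda>n. norm (b n))"
    using assms(1-3) by (rule summable_norm_le_geometric)
  hence s': "summable (\<lambda>n. norm (b (Suc n)))"
    using summable_Suc_iff[of "\<lambda>n. norm (b n)"] by simp
  have geo: "(\<lambda>n. r ^ Suc n) sums (r / (1 - r))"
    using sums_mult[OF geometric_sums[of r], of r] assms by simp
  have "suminf b - 1 = (\<Sum>n. b (Suc n))"
    using suminf_split_head[OF summable_norm_cancel[OF s]] assms by simp
  also have "norm \<dots> \<le> (\<Sum>n. norm (b (Suc n)))"
    by (rule summable_norm[OF s'])
  also have "\<dots> \<le> (\<Sum>n. r ^ Suc n)"
    by (rule suminf_le[OF assms(3) s' sums_summable[OF geo]])
  also have "\<dots> = r / (1 - r)"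
    using geo by (simp add: sums_iff)
  finally show ?thesis .
qed

lemma infsum_int_eq_suminf:
  fixes a :: "int \<Rightarrow> complex"
  assumes "0 \<le> r" "r < 1"
    and pos: "\<And>n. norm (a (int n)) \<le> r ^ n"
    and neg: "\<And>n. norm (a (- 1 - int n)) \<le> r ^ n"
  shows "infsum a UNIV = (\<Sum>n. a (int n)) + (\<Sum>n. a (- 1 - int n))"
proof -
  have s: "a summable_on A" for A
    using abs_summable_summable[OF abs_summable_on_int_geometric[OF assms]]
    by (rule summable_on_subset_banach) auto
  have nat: "infsum b UNIV = suminf b" if "\<And>n. norm (b n) \<le> r ^ n" for b :: "nat \<Rightarrow> complex"
  proof -
    have sb: "summable (\<lambda>n. norm (b n))"
      using assms(1,2) that by (rule summable_norm_le_geometric)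
    show ?thesis
      by (rule infsumI[OF norm_summable_imp_has_sum[OF sb summable_sums[OF summable_norm_cancel[OF sb]]]])
  qed
  have "infsum a UNIV = infsum a {0..} + infsum a {..<0}"
    unfolding UNIV_int_split by (rule infsum_Un_disjoint[OF s s]) auto
  also have "infsum a {0..} = (\<Sum>n. a (int n))"
    using infsum_reindex_bij_betw[OF bij_int_nonneg, of a] nat[OF pos] by simp
  also have "infsum a {..<0} = (\<Sum>n. a (- 1 - int n))"
    using infsum_reindex_bij_betw[OF bij_int_neg, of a] nat[OF neg] by simp
  finally show ?thesis .
qed

lemma infsum_power_int_eq_suminf:
  fixes q :: complex and e :: "int \<Rightarrow> int"
  assumes "norm q < 1" "\<And>n. int n \<le> e (int n)" "\<And>n. int n \<le> e (- 1 - int n)"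
  shows "(\<Sum>\<^sub>\<infinity>m. q powi (e m)) = (\<Sum>n. q powi (e (int n))) + (\<Sum>n. q powi (e (- 1 - int n)))"
  by (rule infsum_int_eq_suminf[of "norm q" "\<lambda>m. q powi (e m)"]) (use assms norm_power_int_le_power in auto)

lemma infsum_int_parity:
  fixes f :: "int \<Rightarrow> complex"
  assumes "f summable_on UNIV"
  shows "infsum f UNIV = (\<Sum>\<^sub>\<infinity>k. f (2 * k)) + (\<Sum>\<^sub>\<infinity>k. f (2 * k + 1))"
proof -
  have U: "(UNIV :: int set) = {m. even m} \<union> {m. odd m}" by auto
  have s: "f summable_on A" for A
    using assms by (rule summable_on_subset_banach) auto
  have "infsum f UNIV = infsum f {m. even m} + infsum f {m. odd m}"
    unfolding U by (rule infsum_Un_disjoint[OF s s]) auto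
  moreover have "bij_betw (\<lambda>k::int. 2 * k) UNIV {m. even m}"
    by (rule bij_betwI[where g = "\<lambda>m. m div 2"]) auto
  moreover have "bij_betw (\<lambda>k::int. 2 * k + 1) UNIV {m. odd m}"
    by (rule bij_betwI[where g = "\<lambda>m. m div 2"]) auto
  ultimately show ?thesis
    using infsum_reindex_bij_betw[of _ _ _ f] by metis
qed

text \<open>The pairs of equal parity form a sublattice of index 2, and those of unequal parity are
  its other coset. Both are parametrised by \<open>n\<close> and half the (shifted)
  difference.\<close>

lemma infsum_int_pair_parity:
  fixes f :: "int \<times> int \<Rightarrow> complex"
  assumes "f summable_on UNIV"
  shows "infsum f UNIV = (\<Sum>\<^sub>\<infinity>(k, n). f (n + 2 * k, n)) + (\<Sum>\<^sub>\<infinity>(k, n). f (n + 2 * k + 1, n))"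
proof -
  have U: "(UNIV :: (int \<times> int) set) = {(m, n). even (m - n)} \<union> {(m, n). odd (m - n)}" by auto
  have s: "f summable_on A" for A
    using assms by (rule summable_on_subset_banach) auto
  have "infsum f UNIV = infsum f {(m, n). even (m - n)} + infsum f {(m, n). odd (m - n)}"
    unfolding U by (rule infsum_Un_disjoint[OF s s]) auto
  moreover have "bij_betw (\<lambda>(k, n). (n + 2 * k, n)) UNIV {(m, n::int). even (m - n)}"
    by (rule bij_betwI[where g = "\<lambda>(m, n). ((m - n) div 2, n)"]) auto
  moreover have "bij_betw (\<lambda>(k, n). (n + 2 * k + 1, n)) UNIV {(m, n::int). odd (m - n)}"
    by (rule bij_betwI[where g = "\<lambda>(m, n). ((m - n - 1) div 2, n)"]) auto
  ultimately show ?thesis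
    using infsum_reindex_bij_betw[of "\<lambda>(k, n). (n + 2 * k, n)" UNIV "{(m, n::int). even (m - n)}" f]
      infsum_reindex_bij_betw[of "\<lambda>(k, n). (n + 2 * k + 1, n)" UNIV "{(m, n::int). odd (m - n)}" f]
    by (simp add: case_prod_unfold)
qed

lemma infsum_product_UNIV:
  fixes a :: "'a \<Rightarrow> complex" and b :: "'b \<Rightarrow> complex"
  assumes "(\<lambda>m. norm (a m)) summable_on UNIV" "(\<lambda>m. norm (b m)) summable_on UNIV"
  shows "(\<lambda>(x, y). a x * b y) summable_on UNIV"
    and "infsum a UNIV * infsum b UNIV = (\<Sum>\<^sub>\<infinity>(x, y). a x * b y)"
proof -
  have "(\<lambda>p. norm ((\<lambda>(x, y). a x * b y) p)) summable_on UNIV \<times> UNIV"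
    unfolding Infinite_Sum.abs_summable_on_Sigma_iff using assms
    by (auto simp: norm_mult infsum_cmult_right' abs_mult infsum_nonneg intro!: summable_on_cmult_right summable_on_cmult_left)
  thus s: "(\<lambda>(x, y). a x * b y) summable_on UNIV"
    by (simp add: abs_summable_summable)
  have "(\<Sum>\<^sub>\<infinity>(x, y). a x * b y) = (\<Sum>\<^sub>\<infinity>x. \<Sum>\<^sub>\<infinity>y. a x * b y)"
    using infsum_Sigma'_banach[of "\<lambda>x y. a x * b y" UNIV "\<lambda>_. UNIV"] s by simp
  also have "\<dots> = infsum a UNIV * infsum b UNIV"
    by (simp add: infsum_cmult_right' infsum_cmult_left')
  finally show "infsum a UNIV * infsum b UNIV = (\<Sum>\<^sub>\<infinity>(x, y). a x * b y)" by simp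
qed

section \<open>The series for the theta functions\<close>

lemma phi_exponent_ge:
  "int n \<le> (int n)\<^sup>2" "int n \<le> (- 1 - int n)\<^sup>2"
proof -
  have "int n \<le> int n * int n" by (cases n) auto
  thus "int n \<le> (int n)\<^sup>2" "int n \<le> (- 1 - int n)\<^sup>2"
    by (auto simp: power2_eq_square algebra_simps)
qed

lemma psi_exponent_ge:
  "int n \<le> int n * (int n + 1)" "int n \<le> (- 1 - int n) * (- 1 - int n + 1)"
  using phi_exponent_ge[of n] by (auto simp: power2_eq_square algebra_simps)

lemma abs_summable_phi:
  fixes q :: complex
  assumes "norm q < 1"
  shows "(\<lambda>m::int. norm (q powi (m\<^sup>2))) summable_on UNIV"
  using assms phi_exponent_ge by (rule abs_summable_power_int)

lemma abs_summable_psi: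
  fixes q :: complex
  assumes "norm q < 1"
  shows "(\<lambda>m::int. norm (q powi (m * (m + 1)))) summable_on UNIV"
  using assms psi_exponent_ge by (rule abs_summable_power_int)

lemma norm_psi_term_le:
  fixes q :: complex
  assumes "norm q < 1"
  shows "norm (q ^ (m * (m + 1) div 2)) \<le> norm q ^ m"
proof -
  have "m * 2 \<le> m * (m + 1)" by (cases m) auto
  hence "m \<le> m * (m + 1) div 2" by linarith
  thus ?thesis using assms by (simp add: norm_power power_decreasing)
qed

text \<open>The exponent \<open>m * (m + 1)\<close> is invariant under
  \<open>m \<mapsto> - 1 - m\<close>, so the two half-lines contribute the same series.\<close>

lemma infsum_psi:
  fixes q :: complex
  assumes "norm q < 1"
  shows "(\<Sum>\<^sub>\<infinity>m::int. q powi (m * (m + 1))) = 2 * ramanujan_psi (q\<^sup>2)"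
proof -
  have t: "(q\<^sup>2) ^ (m * (m + 1) div 2) = q ^ (m * (m + 1))" for m :: nat
    by (simp flip: power_mult)
  have "int n * (int n + 1) = int (n * (n + 1))"
    "(- 1 - int n) * (- 1 - int n + 1) = int (n * (n + 1))" for n
    by (auto simp: algebra_simps)
  hence e: "q powi (int n * (int n + 1)) = q ^ (n * (n + 1))"
    "q powi ((- 1 - int n) * (- 1 - int n + 1)) = q ^ (n * (n + 1))" for n
    by (simp_all only: power_int_of_nat)
  have "(\<Sum>\<^sub>\<infinity>m::int. q powi (m * (m + 1))) = (\<Sum>n. q ^ (n * (n + 1))) + (\<Sum>n. q ^ (n * (n + 1)))"
    using infsum_power_int_eq_suminf[OF assms psi_exponent_ge] by (simp only: e)
  thus ?thesis
    by (simp only: ramanujan_psi_def t mult_2)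
qed

lemma ramanujan_psi_nonzero_small:
  assumes "norm q < 1 / 4"
  shows "ramanujan_psi q \<noteq> 0"
proof -
  have q: "norm q < 1" using assms by simp
  have "norm (ramanujan_psi q - 1) \<le> norm q / (1 - norm q)"
    unfolding ramanujan_psi_def
    by (rule norm_suminf_minus_1_le) (use q norm_psi_term_le in auto)
  also have "\<dots> < 1"
    using assms by (simp add: field_simps)
  finally show ?thesis by auto
qed

lemma ramanujan_phi_nonzero_small:
  assumes "norm q < 1 / 4"
  shows "ramanujan_phi q \<noteq> 0"
proof -
  let ?b = "\<lambda>n. q powi (int n)\<^sup>2"
  have q: "norm q < 1" using assms by simp
  have b: "norm (?b n) \<le> norm q ^ n" for n
    using q phi_exponent_ge(1) by (rule norm_power_int_le_power)
  have "summable ?b"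
    by (rule summable_norm_cancel[OF summable_norm_le_geometric[OF norm_ge_zero q b]])
  hence "(\<Sum>n. ?b (Suc n)) = suminf ?b - 1"
    using suminf_split_head[of ?b] by simp
  \<comment> \<open>The negative half-line repeats the squares from 1 on, so it is the nonnegative
    half without its constant term.\<close>
  moreover have "q powi (- 1 - int n)\<^sup>2 = ?b (Suc n)" for n
    by (rule arg_cong[of _ _ "(powi) q"]) (simp add: power2_eq_square algebra_simps)
  moreover have "ramanujan_phi q = suminf ?b + (\<Sum>n. q powi (- 1 - int n)\<^sup>2)"
    unfolding ramanujan_phi_def using q phi_exponent_ge by (rule infsum_power_int_eq_suminf)
  ultimately have eq: "ramanujan_phi q = 1 + 2 * (suminf ?b - 1)"
    by simp
  have "norm (suminf ?b - 1) \<le> norm q / (1 - norm q)"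
    by (rule norm_suminf_minus_1_le) (use q b in auto)
  \<comment> \<open>The tail is counted twice in \<open>ramanujan_phi q\<close>, so it must stay
    below 1/2; this holds for \<open>norm q < 1 / 3\<close>, hence below 1/4.\<close>
  also have "\<dots> < 1 / 2"
    using assms by (simp add: field_simps)
  finally have "norm (2 * (suminf ?b - 1)) < 1"
    unfolding norm_mult by simp
  thus ?thesis
    using norm_minus_cancel[of "2 * (suminf ?b - 1)"] unfolding eq add_eq_0_iff by auto
qed

section \<open>Theta function identities\<close>

lemma power_power_int: "(q ^ n) powi e = q powi (int n * e)" for q :: complex
  by (simp add: power_int_mult)

text \<open>Split by the parity of the index: even squares are \<open>4 * k^2\<close>, odd ones are
  \<open>4 * k * (k + 1) + 1\<close>, which gives the bilateral series for psi.\<close>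

lemma phi_dissection:
  assumes "q \<noteq> 0" "norm q < 1"
  shows "ramanujan_phi q = ramanujan_phi (q ^ 4) + 2 * q * ramanujan_psi (q ^ 8)"
proof -
  have q4: "norm (q ^ 4) < 1"
    using assms by (simp add: norm_power power_less_one_iff)
  have even: "q powi (2 * k)\<^sup>2 = (q ^ 4) powi k\<^sup>2" for k
    unfolding power_power_int by (simp add: power2_eq_square)
  have odd: "q powi (2 * k + 1)\<^sup>2 = q * (q ^ 4) powi (k * (k + 1))" for k
  proof -
    have e: "(2 * k + 1)\<^sup>2 = int 4 * (k * (k + 1)) + 1"
      by (simp add: power2_eq_square algebra_simps)
    show ?thesis
      unfolding power_power_int e using assms by (simp add: power_int_add)
  qed
  have "ramanujan_phi q = ramanujan_phi (q ^ 4) + q * (\<Sum>\<^sub>\<infinity>k. (q ^ 4) powi (k * (k + 1)))"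
    unfolding ramanujan_phi_def
    using infsum_int_parity[OF abs_summable_summable[OF abs_summable_phi[OF assms(2)]]]
    by (simp only: even odd infsum_cmult_right')
  also have "(\<Sum>\<^sub>\<infinity>k. (q ^ 4) powi (k * (k + 1))) = 2 * ramanujan_psi (q ^ 8)"
    using infsum_psi[OF q4] by (simp flip: power_mult)
  finally show ?thesis by simp
qed

text \<open>On each parity class of pairs, \<open>x^2 + y^2\<close> is rewritten by a rotation
  through 45 degrees with scaling: as twice a sum of two squares, or as 1 plus twice a sum of two
  products \<open>x * (x + 1)\<close>.\<close>

lemma phi_square:
  assumes "q \<noteq> 0" "norm q < 1"
  shows "(ramanujan_phi q)\<^sup>2 = (ramanujan_phi (q\<^sup>2))\<^sup>2 + 4 * q * (ramanujan_psi (q ^ 4))\<^sup>2"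
proof -
  let ?f = "\<lambda>(x, y). q powi x\<^sup>2 * q powi y\<^sup>2 :: complex"
  have q2: "norm (q\<^sup>2) < 1"
    using assms by (simp add: norm_power power_less_one_iff)
  note phi = abs_summable_phi[OF assms(2)]
  \<comment> \<open>This shear makes the two new coordinates \<open>k\<close> and
    \<open>n + k\<close> independent, so that each sum factors again.\<close>
  have bij: "bij_betw (\<lambda>(k, n). (k, n + k)) UNIV (UNIV :: (int \<times> int) set)"
    by (rule bij_betwI[where g = "\<lambda>(x, y). (x, y - x)"]) auto
  have even: "q powi (n + 2 * k)\<^sup>2 * q powi n\<^sup>2 = (q\<^sup>2) powi k\<^sup>2 * (q\<^sup>2) powi (n + k)\<^sup>2" for k n
    unfolding power_power_int power_int_add[OF disjI1[OF assms(1)], symmetric]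
    by (rule arg_cong[of _ _ "(powi) q"]) (simp add: power2_eq_square algebra_simps)
  have odd: "q powi (n + 2 * k + 1)\<^sup>2 * q powi n\<^sup>2 =
      q * ((q\<^sup>2) powi (k * (k + 1)) * (q\<^sup>2) powi ((n + k) * (n + k + 1)))" (is "?l = ?r") for k n
  proof -
    have "?l = q powi (1 + (2 * (k * (k + 1)) + 2 * ((n + k) * (n + k + 1))))"
      unfolding power_int_add[OF disjI1[OF assms(1)], symmetric]
      by (rule arg_cong[of _ _ "(powi) q"]) (simp add: power2_eq_square algebra_simps)
    also have "\<dots> = ?r"
      unfolding power_power_int power_int_add[OF disjI1[OF assms(1)]] by simp
    finally show ?thesis .
  qed
  have "(ramanujan_phi q)\<^sup>2 = infsum ?f UNIV"
    unfolding ramanujan_phi_def power2_eq_square[of "infsum _ _"] by (rule infsum_product_UNIV(2)[OF phi phi])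
  also have "\<dots> = (\<Sum>\<^sub>\<infinity>(k, n). (q\<^sup>2) powi k\<^sup>2 * (q\<^sup>2) powi (n + k)\<^sup>2) +
      (\<Sum>\<^sub>\<infinity>(k, n). q * ((q\<^sup>2) powi (k * (k + 1)) * (q\<^sup>2) powi ((n + k) * (n + k + 1))))"
    using infsum_int_pair_parity[OF infsum_product_UNIV(1)[OF phi phi]] by (simp only: prod.case even odd)
  also have "(\<Sum>\<^sub>\<infinity>(k, n). (q\<^sup>2) powi k\<^sup>2 * (q\<^sup>2) powi (n + k)\<^sup>2) = (\<Sum>\<^sub>\<infinity>(x, y). (q\<^sup>2) powi x\<^sup>2 * (q\<^sup>2) powi y\<^sup>2)"
    using infsum_reindex_bij_betw[OF bij, of "\<lambda>(x, y). (q\<^sup>2) powi x\<^sup>2 * (q\<^sup>2) powi y\<^sup>2"]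
    by (simp only: case_prod_unfold fst_conv snd_conv)
  also have "\<dots> = (ramanujan_phi (q\<^sup>2))\<^sup>2"
    unfolding ramanujan_phi_def power2_eq_square[of "infsum _ _"]
    by (rule infsum_product_UNIV(2)[OF abs_summable_phi[OF q2] abs_summable_phi[OF q2], symmetric])
  also have "(\<Sum>\<^sub>\<infinity>(k, n). q * ((q\<^sup>2) powi (k * (k + 1)) * (q\<^sup>2) powi ((n + k) * (n + k + 1)))) =
      (\<Sum>\<^sub>\<infinity>(x, y). q * ((q\<^sup>2) powi (x * (x + 1)) * (q\<^sup>2) powi (y * (y + 1))))"
    using infsum_reindex_bij_betw[OF bij, of "\<lambda>(x, y). q * ((q\<^sup>2) powi (x * (x + 1)) * (q\<^sup>2) powi (y * (y + 1)))"]
    by (simp only: case_prod_unfold fst_conv snd_conv)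
  also have "\<dots> = q * (\<Sum>\<^sub>\<infinity>(x, y). (q\<^sup>2) powi (x * (x + 1)) * (q\<^sup>2) powi (y * (y + 1)))"
    by (simp add: case_prod_unfold infsum_cmult_right')
  also have "\<dots> = q * ((2 * ramanujan_psi ((q\<^sup>2)\<^sup>2)) * (2 * ramanujan_psi ((q\<^sup>2)\<^sup>2)))"
    by (simp only: infsum_product_UNIV(2)[OF abs_summable_psi[OF q2] abs_summable_psi[OF q2], symmetric] infsum_psi[OF q2])
  also have "(q\<^sup>2)\<^sup>2 = q ^ 4"
    by (simp flip: power_mult)
  finally show ?thesis
    by (simp add: power2_eq_square)
qed

text \<open>
  The change of variables below is multiplication of \<open>x + y\<surd>-3\<close> by the unit \<open>(1 + \<surd>-3)/2\<close>: it carries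
  the odd part of the lattice for \<open>x\<^sup>2 + 3y\<^sup>2\<close> onto half of the shifted lattice belonging to
  \<open>\<psi>(q\<^sup>2)\<psi>(q\<^sup>6)\<close>; a reflection identifies the two halves.
\<close>

lemma phi_cubic_identity:
  assumes "q \<noteq> 0" "norm q < 1"
  shows "ramanujan_phi q * ramanujan_phi (q ^ 3) - ramanujan_phi (- q) * ramanujan_phi (- (q ^ 3)) =
    4 * q * ramanujan_psi (q\<^sup>2) * ramanujan_psi (q ^ 6)"
proof -
  have q3: "norm (q ^ 3) < 1"
    using assms by (simp add: norm_power power_less_one_iff)
  have m: "norm (- q) < 1" "norm (- (q ^ 3)) < 1"
    using assms q3 by simp_all
  note add = power_int_add[OF disjI1[OF assms(1)]]
  \<comment> \<open>\<open>E\<close> and \<open>S\<close> are the even and odd parts of the sum for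
    \<open>x^2 + 3 * y^2\<close>; \<open>U\<close> and \<open>V\<close> are the corresponding parts
    of the bilateral psi product.\<close>
  define E where "E = (\<Sum>\<^sub>\<infinity>(k, n). q powi (n + 2 * k)\<^sup>2 * (q ^ 3) powi n\<^sup>2)"
  define S where "S = (\<Sum>\<^sub>\<infinity>(k, n). q powi (n + 2 * k + 1)\<^sup>2 * (q ^ 3) powi n\<^sup>2)"
  define U where "U = (\<Sum>\<^sub>\<infinity>(k, n). q powi ((n + 2 * k) * (n + 2 * k + 1)) * (q ^ 3) powi (n * (n + 1)))"
  define V where "V = (\<Sum>\<^sub>\<infinity>(k, n). q powi ((n + 2 * k + 1) * (n + 2 * k + 1 + 1)) * (q ^ 3) powi (n * (n + 1)))"
  have plus: "ramanujan_phi q * ramanujan_phi (q ^ 3) = E + S"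
    unfolding ramanujan_phi_def E_def S_def infsum_product_UNIV(2)[OF abs_summable_phi[OF assms(2)] abs_summable_phi[OF q3]]
    using infsum_int_pair_parity[OF infsum_product_UNIV(1)[OF abs_summable_phi[OF assms(2)] abs_summable_phi[OF q3]]]
    by (simp only: prod.case)
  \<comment> \<open>The form \<open>x^2 + 3 * y^2\<close> has the parity of \<open>x - y\<close>, so
    changing the sign of \<open>q\<close> fixes \<open>E\<close> and negates \<open>S\<close>; the
    left side of the identity is therefore \<open>2 * S\<close>.\<close>
  have even: "(- q) powi (n + 2 * k)\<^sup>2 * (- (q ^ 3)) powi n\<^sup>2 = q powi (n + 2 * k)\<^sup>2 * (q ^ 3) powi n\<^sup>2" for k n
    by (cases "even n") simp_all
  have odd: "(- q) powi (n + 2 * k + 1)\<^sup>2 * (- (q ^ 3)) powi n\<^sup>2 =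
      - (q powi (n + 2 * k + 1)\<^sup>2 * (q ^ 3) powi n\<^sup>2)" for k n
    by (cases "even n") simp_all
  have "ramanujan_phi (- q) * ramanujan_phi (- (q ^ 3)) =
      E + (\<Sum>\<^sub>\<infinity>(k, n). - (q powi (n + 2 * k + 1)\<^sup>2 * (q ^ 3) powi n\<^sup>2))"
    unfolding ramanujan_phi_def E_def infsum_product_UNIV(2)[OF abs_summable_phi[OF m(1)] abs_summable_phi[OF m(2)]]
    using infsum_int_pair_parity[OF infsum_product_UNIV(1)[OF abs_summable_phi[OF m(1)] abs_summable_phi[OF m(2)]]]
    by (simp only: prod.case even odd)
  also have "\<dots> = E - S"
    by (simp add: S_def case_prod_unfold infsum_uminus)
  finally have minus: "ramanujan_phi (- q) * ramanujan_phi (- (q ^ 3)) = E - S" .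
  have q6: "(q ^ 3)\<^sup>2 = q ^ 6"
    by (simp flip: power_mult)
  have "4 * (ramanujan_psi (q\<^sup>2) * ramanujan_psi (q ^ 6)) =
      (\<Sum>\<^sub>\<infinity>m::int. q powi (m * (m + 1))) * (\<Sum>\<^sub>\<infinity>m::int. (q ^ 3) powi (m * (m + 1)))"
    by (simp add: infsum_psi[OF assms(2)] infsum_psi[OF q3] q6)
  also have "\<dots> = U + V"
    unfolding U_def V_def infsum_product_UNIV(2)[OF abs_summable_psi[OF assms(2)] abs_summable_psi[OF q3]]
    using infsum_int_pair_parity[OF infsum_product_UNIV(1)[OF abs_summable_psi[OF assms(2)] abs_summable_psi[OF q3]]]
    by (simp only: prod.case)
  \<comment> \<open>The reflection \<open>x \<mapsto> - 1 - x\<close> with \<open>y\<close> fixed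
    preserves \<open>x * (x + 1)\<close> and flips the parity of \<open>x - y\<close>.\<close>
  also have "U = V"
  proof -
    have bij: "bij_betw (\<lambda>(k, n). (- 1 - k - n, n)) UNIV (UNIV :: (int \<times> int) set)"
      by (rule bij_betwI[where g = "\<lambda>(k, n). (- 1 - k - n, n)"]) auto
    have "(n + 2 * (- 1 - k - n)) * (n + 2 * (- 1 - k - n) + 1) = (n + 2 * k + 1) * (n + 2 * k + 1 + 1)" for k n :: int
      by (simp add: algebra_simps)
    thus ?thesis
      unfolding U_def V_def
      using infsum_reindex_bij_betw[OF bij, of "\<lambda>(k, n). q powi ((n + 2 * k) * (n + 2 * k + 1)) * (q ^ 3) powi (n * (n + 1))"]
      by (simp only: case_prod_unfold fst_conv snd_conv)
  qed
  finally have psi: "V + V = 4 * (ramanujan_psi (q\<^sup>2) * ramanujan_psi (q ^ 6))" ..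
  \<comment> \<open>Completing squares in the exponent of \<open>U\<close> with
    \<open>X = n + 2 * k + 1/2\<close>, \<open>Y = n + 1/2\<close> gives
    \<open>X^2 + 3 * Y^2 - 1\<close>, whence the factor \<open>q\<close>. The map below is
    \<open>x = (X + 3 * Y) / 2\<close>, \<open>y = (Y - X) / 2\<close>, which preserves the
    form.\<close>
  have "S = q * U"
  proof -
    have bij: "bij_betw (\<lambda>(k, n). (n + k, - k)) UNIV (UNIV :: (int \<times> int) set)"
      by (rule bij_betwI[where g = "\<lambda>(k, n). (- n, k + n)"]) auto
    have e: "q powi (- k + 2 * (n + k) + 1)\<^sup>2 * (q ^ 3) powi (- k)\<^sup>2 =
        q * (q powi ((n + 2 * k) * (n + 2 * k + 1)) * (q ^ 3) powi (n * (n + 1)))" (is "?l = ?r") for k n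
    proof -
      have "?l = q powi (1 + ((n + 2 * k) * (n + 2 * k + 1) + int 3 * (n * (n + 1))))"
        unfolding power_power_int add[symmetric]
        by (rule arg_cong[of _ _ "(powi) q"]) (simp add: power2_eq_square algebra_simps)
      also have "\<dots> = ?r"
        unfolding power_power_int add by simp
      finally show ?thesis .
    qed
    have "S = (\<Sum>\<^sub>\<infinity>(k, n). q powi (- k + 2 * (n + k) + 1)\<^sup>2 * (q ^ 3) powi (- k)\<^sup>2)"
      unfolding S_def
      using infsum_reindex_bij_betw[OF bij, of "\<lambda>(k, n). q powi (n + 2 * k + 1)\<^sup>2 * (q ^ 3) powi n\<^sup>2"]
      by (simp only: case_prod_unfold fst_conv snd_conv)
    also have "\<dots> = q * U"
      unfolding e U_def by (simp add: case_prod_unfold infsum_cmult_right')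
    finally show ?thesis .
  qed
  with plus minus psi \<open>U = V\<close> show ?thesis
    by (simp add: algebra_simps)
qed

text \<open>By the dissection, phi at \<open>q\<close> and \<open>- q\<close> is
  \<open>?a + 2 * ?c\<close> and \<open>?a - 2 * ?c\<close>. Comparing the square and the product of
  these with \<open>phi_square\<close> at \<open>q\<close>, \<open>q^2\<close> and
  \<open>- (q^2)\<close> isolates the mixed term and the difference of squares.\<close>

lemma phi_psi_doubling:
  assumes "q \<noteq> 0" "norm q < 1"
  shows "ramanujan_phi (q ^ 4) * ramanujan_psi (q ^ 8) = (ramanujan_psi (q ^ 4))\<^sup>2"
    and "ramanujan_phi q * ramanujan_phi (- q) = (ramanujan_phi (- (q\<^sup>2)))\<^sup>2"
proof -
  let ?a = "ramanujan_phi (q ^ 4)" and ?c = "q * ramanujan_psi (q ^ 8)"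
  have q2: "q\<^sup>2 \<noteq> 0" "norm (q\<^sup>2) < 1" "- (q\<^sup>2) \<noteq> 0" "norm (- (q\<^sup>2)) < 1"
    and m: "- q \<noteq> 0" "norm (- q) < 1"
    using assms by (auto simp: norm_power power_less_one_iff)
  have plus: "ramanujan_phi q = ?a + 2 * ?c"
    using phi_dissection[OF assms] by simp
  have minus: "ramanujan_phi (- q) = ?a - 2 * ?c"
    using phi_dissection[OF m] by simp
  have "(ramanujan_phi (q\<^sup>2))\<^sup>2 = ?a\<^sup>2 + 4 * ?c\<^sup>2"
    using phi_square[OF q2(1,2)] by (simp add: power_mult_distrib flip: power_mult)
  hence "4 * q * (ramanujan_psi (q ^ 4))\<^sup>2 = 4 * q * (?a * ramanujan_psi (q ^ 8))"
    using phi_square[OF assms] unfolding plus by (auto simp: power2_eq_square algebra_simps)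
  thus "?a * ramanujan_psi (q ^ 8) = (ramanujan_psi (q ^ 4))\<^sup>2"
    using assms by simp
  have "(ramanujan_phi (- (q\<^sup>2)))\<^sup>2 = ?a\<^sup>2 - 4 * ?c\<^sup>2"
    using phi_square[OF q2(3,4)] by (simp add: power_mult_distrib flip: power_mult)
  thus "ramanujan_phi q * ramanujan_phi (- q) = (ramanujan_phi (- (q\<^sup>2)))\<^sup>2"
    unfolding plus minus by (simp add: power2_eq_square algebra_simps)
qed

text \<open>This is the first doubling formula transported to a fourth root of \<open>q\<close>,
  which again lies in the unit disc.\<close>

lemma phi_mult_psi:
  assumes "q \<noteq> 0" "norm q < 1"
  shows "ramanujan_phi q * ramanujan_psi (q\<^sup>2) = (ramanujan_psi q)\<^sup>2"
proof -
  obtain s where s: "q = s ^ 4"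
  proof
    have "csqrt (csqrt q) ^ (2 * 2) = q"
      unfolding power_mult power2_csqrt ..
    thus "q = csqrt (csqrt q) ^ 4" by simp
  qed
  have "s \<noteq> 0" "norm s < 1"
    using assms unfolding s by (auto simp: norm_power power_less_one_iff)
  moreover have "(s ^ 4)\<^sup>2 = s ^ 8"
    by (simp flip: power_mult)
  ultimately show ?thesis
    using phi_psi_doubling(1)[of s] unfolding s by simp
qed

text \<open>Jacobi's quartic identity: a difference of squares of the two instances of
  \<open>phi_square\<close>, whose product term \<open>?a * ?b\<close> is a square of psi by
  \<open>phi_mult_psi\<close>.\<close>

lemma phi_fourth_power_diff:
  assumes "q \<noteq> 0" "norm q < 1"
  shows "ramanujan_phi q ^ 4 - ramanujan_phi (- q) ^ 4 = 16 * q * ramanujan_psi (q\<^sup>2) ^ 4"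
proof -
  have q2: "q\<^sup>2 \<noteq> 0" "norm (q\<^sup>2) < 1" and m: "- q \<noteq> 0" "norm (- q) < 1"
    using assms by (auto simp: norm_power power_less_one_iff)
  let ?a = "ramanujan_phi (q\<^sup>2)" and ?b = "ramanujan_psi (q ^ 4)"
  have sq: "x ^ 4 = (x\<^sup>2)\<^sup>2" for x :: complex
    by (simp flip: power_mult)
  have plus: "(ramanujan_phi q)\<^sup>2 = ?a\<^sup>2 + 4 * q * ?b\<^sup>2"
    by (rule phi_square[OF assms])
  have minus: "(ramanujan_phi (- q))\<^sup>2 = ?a\<^sup>2 - 4 * q * ?b\<^sup>2"
    using phi_square[OF m] by simp
  have "ramanujan_psi (q\<^sup>2) ^ 4 = (?a * ?b)\<^sup>2"
    using phi_mult_psi[OF q2] by (simp only: sq)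
  thus ?thesis
    unfolding sq[of "ramanujan_phi _"] plus minus by (simp add: power2_eq_square algebra_simps)
qed

section \<open>Nonvanishing\<close>

text \<open>
  By the duplication formulas a zero would propagate along \<open>q \<mapsto> q\<^sup>2\<close> towards the origin,
  where the constant term \<open>1\<close> dominates.
\<close>

lemma not_stable_under_squaring:
  fixes q :: complex
  assumes "norm q < 1" "Z q"
    and step: "\<And>x. norm x < 1 \<Longrightarrow> Z x \<Longrightarrow> Z (x\<^sup>2)"
    and small: "\<And>x. norm x < 1 / 4 \<Longrightarrow> \<not> Z x"
  shows False
proof -
  have "Z (q ^ (2 ^ n)) \<and> norm (q ^ (2 ^ n)) < 1" for n
  proof (induction n)
    case (Suc n)
    have "q ^ (2 ^ Suc n) = (q ^ (2 ^ n))\<^sup>2"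
      by (simp add: mult.commute flip: power_mult)
    with Suc step[of "q ^ (2 ^ n)"] show ?case
      by (simp add: norm_power power_less_one_iff)
  qed (use assms in auto)
  moreover obtain n where "norm q ^ n < 1 / 4"
    using real_arch_pow_inv[of "1 / 4" "norm q"] assms by auto
  moreover have "norm q ^ (2 ^ n) \<le> norm q ^ n"
    using assms by (intro power_decreasing) (auto simp: less_imp_le)
  ultimately show False
    using small[of "q ^ (2 ^ n)"] by (simp add: norm_power)
qed

lemma ramanujan_phi_nonzero:
  assumes "norm q < 1"
  shows "ramanujan_phi q \<noteq> 0"
proof
  assume "ramanujan_phi q = 0"
  \<comment> \<open>The product formula leads from a zero at \<open>- x\<close> to one at
    \<open>- (x^2)\<close>, so the property propagated is the vanishing at
    \<open>- x\<close>.\<close>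
  hence zero: "ramanujan_phi (- (- q)) = 0" by simp
  have "norm (- q) < 1" using assms by simp
  thus False
  proof (rule not_stable_under_squaring[where Z = "\<lambda>x. ramanujan_phi (- x) = 0", OF _ zero])
    fix x :: complex
    assume x: "norm x < 1" "ramanujan_phi (- x) = 0"
    hence "x \<noteq> 0" using ramanujan_phi_nonzero_small[of 0] by auto
    with x phi_psi_doubling(2)[of x] show "ramanujan_phi (- (x\<^sup>2)) = 0" by simp
  qed (simp add: ramanujan_phi_nonzero_small)
qed

text \<open>In \<open>phi_mult_psi\<close> the phi factor is already known to be nonzero, so a zero
  of psi at \<open>x\<close> passes to \<open>x^2\<close>.\<close>

lemma ramanujan_psi_nonzero:
  assumes "norm q < 1"
  shows "ramanujan_psi q \<noteq> 0"
proof
  assume "ramanujan_psi q = 0"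
  with assms show False
  proof (rule not_stable_under_squaring[where Z = "\<lambda>x. ramanujan_psi x = 0"])
    fix x :: complex
    assume x: "norm x < 1" "ramanujan_psi x = 0"
    hence "x \<noteq> 0" using ramanujan_psi_nonzero_small[of 0] by auto
    with x phi_mult_psi[of x] ramanujan_phi_nonzero[of x] show "ramanujan_psi (x\<^sup>2) = 0" by simp
  qed (simp add: ramanujan_psi_nonzero_small)
qed

section \<open>The modular equation\<close>

text \<open>The quantities \<open>d\<close> and \<open>e\<close> enter only through
  \<open>d * e\<close>, which is eliminated. The terms \<open>u^4 * v^4\<close> and 256 then cancel,
  and a factor 16 remains.\<close>

lemma modular_equation_of_quartics:
  fixes u v d e :: complex
  assumes u: "u ^ 4 - d ^ 4 = 16" and v: "v ^ 4 - e ^ 4 = 16" and uv: "u * v - d * e = 4"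
  shows "u ^ 4 + v ^ 4 = u ^ 3 * v ^ 3 - 6 * u\<^sup>2 * v\<^sup>2 + 16 * u * v"
proof -
  have "(u ^ 4 - 16) * (v ^ 4 - 16) = (d * e) ^ 4"
    using u v by (simp add: power_mult_distrib algebra_simps)
  also have "d * e = u * v - 4"
    using uv by (simp add: algebra_simps)
  finally have "(u ^ 4 - 16) * (v ^ 4 - 16) - (u * v - 4) ^ 4 = 0"
    by simp
  also have "(u ^ 4 - 16) * (v ^ 4 - 16) - (u * v - 4) ^ 4 =
      16 * ((u ^ 3 * v ^ 3 - 6 * u\<^sup>2 * v\<^sup>2 + 16 * u * v) - (u ^ 4 + v ^ 4))"
    by (simp add: eval_nat_numeral algebra_simps)
  finally show ?thesis
    by (simp only: mult_eq_0_iff) simp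
qed

lemma modular_equation_rational:
  fixes P Q :: complex
  assumes "P \<noteq> 0" "Q \<noteq> 0"
    and "(P + 2) ^ 4 + (Q + 2) ^ 4 =
      (P + 2) ^ 3 * (Q + 2) ^ 3 - 6 * (P + 2)\<^sup>2 * (Q + 2)\<^sup>2 + 16 * (P + 2) * (Q + 2)"
  shows "(P / Q)\<^sup>2 + 1 / (P / Q)\<^sup>2 =
    12 * (P / Q + 1 / (P / Q)) + (P * Q + 64 / (P * Q)) + 6 * (P + Q + 8 / P + 8 / Q) + 30"
proof -
  \<comment> \<open>\<open>?R\<close> is the right side of the claim multiplied by
    \<open>P^2 * Q^2\<close>; the left side becomes \<open>P^4 + Q^4\<close>.\<close>
  let ?R = "12 * (P ^ 3 * Q + P * Q ^ 3) + P ^ 3 * Q ^ 3 + 64 * P * Q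
    + 6 * (P ^ 3 * Q\<^sup>2 + P\<^sup>2 * Q ^ 3 + 8 * P * Q\<^sup>2 + 8 * P\<^sup>2 * Q) + 30 * P\<^sup>2 * Q\<^sup>2"
  have "?R - (P ^ 4 + Q ^ 4) = (P + 2) ^ 3 * (Q + 2) ^ 3 - 6 * (P + 2)\<^sup>2 * (Q + 2)\<^sup>2
      + 16 * (P + 2) * (Q + 2) - ((P + 2) ^ 4 + (Q + 2) ^ 4)"
    by (simp add: eval_nat_numeral algebra_simps)
  also have "\<dots> = 0"
    unfolding assms(3) by simp
  finally have "P ^ 4 + Q ^ 4 = ?R"
    by simp
  moreover have "(P / Q)\<^sup>2 + 1 / (P / Q)\<^sup>2 = (P ^ 4 + Q ^ 4) / (P\<^sup>2 * Q\<^sup>2)"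
    using assms(1,2) by (simp add: divide_simps flip: power_add)
  moreover have "12 * (P / Q + 1 / (P / Q)) + (P * Q + 64 / (P * Q)) + 6 * (P + Q + 8 / P + 8 / Q) + 30
      = ?R / (P\<^sup>2 * Q\<^sup>2)"
    using assms(1,2) by (simp add: divide_simps) (simp add: eval_nat_numeral algebra_simps)
  ultimately show ?thesis by simp
qed

theorem theorem3p4:
  fixes q sqrtA sqrtB :: complex
  assumes "0 < norm q" and "norm q < 1"
    and "admissible_roots q sqrtA sqrtB"
  shows "(B3 q)\<^sup>2 + 1 / (B3 q)\<^sup>2 =
           12 * (B3 q + 1 / B3 q)
         + (A3 q + 8\<^sup>2 / A3 q)
         + 6 * (sqrtA + 8 / sqrtA) * (sqrtB + 1 / sqrtB)
         + 30"
proof -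
  have q: "q \<noteq> 0" "- q \<noteq> 0" "norm (- q) < 1"
    and q3: "q ^ 3 \<noteq> 0" "norm (- (q ^ 3)) < 1" "- (q ^ 3) \<noteq> 0"
    and q4: "q ^ 4 \<noteq> 0" "norm (q ^ 4) < 1"
    and q8: "norm (q ^ 8) < 1" and q12: "q ^ 12 \<noteq> 0" "norm (q ^ 12) < 1"
    and q24: "norm (q ^ 24) < 1"
    using assms by (auto simp: norm_power power_less_one_iff)
  \<comment> \<open>The capitals \<open>A\<close>, \<open>D\<close>, \<open>C\<close> below are
    \<open>a\<close>, \<open>d\<close>, \<open>c\<close> with \<open>q\<close> replaced by
    \<open>q^3\<close>.\<close>
  define a d c where "a = ramanujan_phi (q ^ 4)" and "d = ramanujan_phi (- (q ^ 4))"
    and "c = q * ramanujan_psi (q ^ 8)"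
  define A D C where "A = ramanujan_phi (q ^ 12)" and "D = ramanujan_phi (- (q ^ 12))"
    and "C = q ^ 3 * ramanujan_psi (q ^ 24)"
  have "q * q ^ 3 = q ^ 4"
    by (simp add: eval_nat_numeral)
  hence cC: "c * C = q ^ 4 * ramanujan_psi (q ^ 8) * ramanujan_psi (q ^ 24)"
    unfolding c_def C_def by (metis mult.assoc mult.left_commute)
  define P Q where "P = ramanujan_phi (- q) / c" and "Q = ramanujan_phi (- (q ^ 3)) / C"
  have nz: "c \<noteq> 0" "C \<noteq> 0" "ramanujan_phi (- q) \<noteq> 0" "ramanujan_phi (- (q ^ 3)) \<noteq> 0"
    using q q3 q8 q24 unfolding c_def C_def
    by (auto simp: ramanujan_psi_nonzero ramanujan_phi_nonzero)
  hence PQ: "P \<noteq> 0" "Q \<noteq> 0"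
    unfolding P_def Q_def by auto

  have "ramanujan_phi (- q) = a - 2 * c"
    using phi_dissection[OF q(2,3)] by (simp add: a_def c_def)
  hence P: "a / c = P + 2"
    using nz by (simp add: P_def field_simps)
  have "ramanujan_phi (- (q ^ 3)) = A - 2 * C"
    using phi_dissection[OF q3(3,2)] by (simp add: A_def C_def flip: power_mult)
  hence Q: "A / C = Q + 2"
    using nz by (simp add: Q_def field_simps)

  \<comment> \<open>At nome \<open>q^4\<close> the right sides are exactly powers of
    \<open>c\<close> and \<open>C\<close> up to constants. Dividing by \<open>c^4\<close>,
    \<open>C^4\<close> and \<open>c * C\<close> yields the hypotheses on \<open>u = a / c\<close>
    and \<open>v = A / C\<close>.\<close>
  have "a ^ 4 - d ^ 4 = 16 * c ^ 4"
    using phi_fourth_power_diff[OF q4]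
    by (simp add: a_def d_def c_def power_mult_distrib flip: power_mult)
  moreover have "A ^ 4 - D ^ 4 = 16 * C ^ 4"
    using phi_fourth_power_diff[OF q12]
    by (simp add: A_def D_def C_def power_mult_distrib flip: power_mult)
  moreover have "a * A - d * D = 4 * (c * C)"
    using phi_cubic_identity[OF q4] cC
    by (simp add: a_def d_def A_def D_def flip: power_mult)
  ultimately have eq: "(P + 2) ^ 4 + (Q + 2) ^ 4 =
      (P + 2) ^ 3 * (Q + 2) ^ 3 - 6 * (P + 2)\<^sup>2 * (Q + 2)\<^sup>2 + 16 * (P + 2) * (Q + 2)"
    using modular_equation_of_quartics[of "a / c" "d / c" "A / C" "D / C"] nz(1,2)
    unfolding P[symmetric] Q[symmetric] by (simp add: power_divide flip: diff_divide_distrib)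

  have A3: "A3 q = P * Q"
    by (simp add: A3_def P_def Q_def flip: cC)
  have B3: "B3 q = P / Q"
    using nz q by (simp add: B3_def P_def Q_def c_def C_def divide_simps power_int_minus power2_eq_square power3_eq_cube)
  have roots: "sqrtA\<^sup>2 = P * Q" "sqrtB\<^sup>2 = P / Q" "sqrtA * sqrtB = P"
    using assms(3) unfolding admissible_roots_def A3 B3 by (simp_all add: P_def c_def)
  hence sqrt_nz: "sqrtA \<noteq> 0" "sqrtB \<noteq> 0"
    using PQ by auto
  \<comment> \<open>The squares alone determine this only up to sign; the prescribed product
    \<open>P\<close> fixes the sign. The four terms of the cross product are then \<open>P\<close>,
    \<open>Q\<close>, \<open>8 / Q\<close> and \<open>8 / P\<close>.\<close>
  have "sqrtA = Q * sqrtB"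
  proof -
    have "sqrtA * sqrtB = Q * sqrtB\<^sup>2"
      using roots PQ by simp
    thus ?thesis using sqrt_nz by (simp add: power2_eq_square)
  qed
  hence cross: "(sqrtA + 8 / sqrtA) * (sqrtB + 1 / sqrtB) = P + Q + 8 / P + 8 / Q"
    using sqrt_nz PQ by (simp add: divide_simps flip: roots(3)) (simp add: algebra_simps)
  show ?thesis
    using modular_equation_rational[OF PQ eq]
    unfolding A3 B3 mult.assoc[of 6 "sqrtA + 8 / sqrtA"] cross by simp
qed

end
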